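(* Let $K$ be a unital semiring, and let $\mathcal C$ be any of the categories $\mathcal P$, $\mathcal B$, $\mathcal{TL}$, or any of their twisted counterparts $\mathcal P^\Phi,\mathcal B^\Phi,\mathcal{TL}^\Phi$, or any of their $e$-twisted counterparts $\mathcal P^{\Phi,e},\mathcal B^{\Phi,e},\mathcal{TL}^{\Phi,e}$ ($e\in\mathbb N$). Then for any faithful involutive tensor category representation $\psi:\mathcal C\to\mathcal M(K)$, there exists an integer $d\ge2$ such that $n\psi=d^n$ for all objects $n\in\mathbb N$.
   Context: **Partition category.** $\mathbb N=\{0,1,2,\ldots\}$, $[n]=\{1,\ldots,n\}$. For $A\subseteq\mathbb N$, $A'$ and $A''$ are disjoint copies of $A$. $\mathcal P_{m,n}$ is the set of all set partitions of $[m]\cup[n]'$; a partition is identified with any graph whose connected components are its blocks. For $a\in\mathcal P_{m,n}$, $b\in\mathcal P_{n,t}$, the product graph $\Pi(a,b)$ has vertex set $[m]\cup[n]''\cup[t]'$ and edges those of $a$ (lower vertices $x'$ renamed $x''$) and of $b$ (upper vertices $x$ renamed $x''$). $ab\in\mathcal P_{m,t}$ is the partition in which $x,y\in[m]\cup[t]'$ are in the same block iff they are in the same component of $\Pi(a,b)$. $\Phi(a,b)$ is the number of connected components of $\Pi(a,b)$ contained in $[n]''$. $\mathcal P$ has object set $\mathbb N$, hom-sets $\mathcal P_{m,n}$, this composition, identities $\iota_n=\{\{i,i'\}:i\in[n]\}$; involution $a\mapsto a^*$ swapping $i\leftrightarrow i'$; and tensor operation $\oplus$, where for $a\in\mathcal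 P_{m,n}$, $b\in\mathcal P_{s,t}$, $a\oplus b\in\mathcal P_{m+s,n+t}$ has as blocks all $a$-blocks and $(X+m)\cup(Y+n)'$ for each $b$-block $X\cup Y'$ (objects add). $\mathcal B\subseteq\mathcal P$ (Brauer category) consists of the partitions all of whose blocks have size $2$; $\mathcal{TL}\subseteq\mathcal B$ (Temperley–Lieb category) consists of those that can be drawn without crossings, with vertex $x\in[m]$ at $(x,1)$, $x'\in[n]'$ at $(x,0)$, and all edges inside the strip $0\le y\le1$. **Twisted categories.** $\mathcal P^\Phi$ has objects $\mathbb N$, hom-sets $\mathbb N\times\mathcal P_{m,n}$, composition $(i,a)(j,b)=(i+j+\Phi(a,b),ab)$, identities $(0,\iota_n)$, involution $(i,a)^*=(i,a^* )$, tensor $(i,a)\oplus(j,b)=(i+j,a\oplus b)$. For $e\in\mathbb N$, $\mathcal P^{\Phi,e}$ has hom-sets $(\{0,\ldots,e\}\times\mathcal P_{m,n})\cup\{\varnothing_{m,n}\}$, with the same operations except that any composite or tensor sum whose integer coordinate would exceed $e$ is replaced by the zero morphism $\varnothing$ of the appropriate hom-set; composites and tensor sums involving a zero morphism are zero morphisms; $\varnothing_{m,n}^*=\varnothing_{n,m}$. The (e-)twisted categories $\mathcal B^\Phi,\mathcal{TL}^\Phi,\mathcal B^{\Phi,e},\mathcal{TL}^{\Phi,e}$ are defined analogously from $\mathcal B$, $\mathcal{TL}$ (with zero morphisms $\varnothing_{m,n}$ only for $m\equiv n\bmod2$). **Matrices.** Semirings have $(K,+,0)$ a commutative monoid, $(K,\cdot,1)$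 a monoid, distributivity, $0$ a multiplicative zero, and are assumed non-trivial ($0\neq1$). $\mathcal M(K)$ has object set $\mathbb N$, hom-sets $\mathcal M_{m,n}(K)$ of $m\times n$ matrices over $K$ (a unique empty matrix if $m=0$ or $n=0$), composition matrix multiplication, involution transpose, and tensor operation the Kronecker product $\otimes$ (objects multiply). **Representations.** A representation is a functor; maps are written on the right, so $n\psi$ is the image of the object $n$. It is faithful if injective on objects and on morphisms, involutive if it preserves the involutions, and a tensor representation if it preserves the tensor operations (on objects it is then a monoid morphism $(\mathbb N,+)\to(\mathbb N,\cdot)$, preserving the identity elements). *)

theory Defs
  imports
    "HOL-Analysis.Path_Connected"
    "HOL-Library.Disjoint_Sets"
    "Jordan_Normal_Form.Matrix"
begin

section \<open>Categories with object set the natural numbers\<close>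

text \<open>
  All categories considered here have object set \<open>\<nat>\<close>. The operations on morphisms are indexed by
  the objects involved: \<open>composite C m n t a b\<close> is the composite, written from left to right, of
  \<open>a : m \<rightarrow> n\<close> and \<open>b : n \<rightarrow> t\<close>, and \<open>tensor C m n s t a b\<close> is the tensor sum/product of
  \<open>a : m \<rightarrow> n\<close> and \<open>b : s \<rightarrow> t\<close>. In all the examples below different hom-sets are disjoint,
  so a morphism carries its source and target.
\<close>

record 'a invtensor_cat =
  homs :: "nat \<Rightarrow> nat \<Rightarrow> 'a set"
  composite :: "nat \<Rightarrow> nat \<Rightarrow> nat \<Rightarrow> 'a \<Rightarrow> 'a \<Rightarrow> 'a"
  identity :: "nat \<Rightarrow> 'a"
  invol :: "'a \<Rightarrow> 'a"
  tensor_obj :: "nat \<Rightarrow> nat \<Rightarrow> nat"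
  tensor_unit :: nat
  tensor :: "nat \<Rightarrow> nat \<Rightarrow> nat \<Rightarrow> nat \<Rightarrow> 'a \<Rightarrow> 'a \<Rightarrow> 'a"

text \<open>In the following, \<open>F\<close> is the action of a functor on objects and \<open>f\<close> its action on morphisms.\<close>

definition is_functor ::
  "'a invtensor_cat \<Rightarrow> 'b invtensor_cat \<Rightarrow> (nat \<Rightarrow> nat) \<Rightarrow> ('a \<Rightarrow> 'b) \<Rightarrow> bool" where
  "is_functor C D F f \<longleftrightarrow>
     (\<forall>m n. \<forall>a \<in> homs C m n. f a \<in> homs D (F m) (F n)) \<and>
     (\<forall>n. f (identity C n) = identity D (F n)) \<and>
     (\<forall>m n t. \<forall>a \<in> homs C m n. \<forall>b \<in> homs C n t.
        f (composite C m n t a b) = composite D (F m) (F n) (F t) (f a) (f b))"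

definition faithful :: "'a invtensor_cat \<Rightarrow> (nat \<Rightarrow> nat) \<Rightarrow> ('a \<Rightarrow> 'b) \<Rightarrow> bool" where
  "faithful C F f \<longleftrightarrow> inj F \<and> inj_on f (\<Union>m n. homs C m n)"

definition preserves_invol ::
  "'a invtensor_cat \<Rightarrow> 'b invtensor_cat \<Rightarrow> ('a \<Rightarrow> 'b) \<Rightarrow> bool" where
  "preserves_invol C D f \<longleftrightarrow>
     (\<forall>m n. \<forall>a \<in> homs C m n. f (invol C a) = invol D (f a))"

text \<open>
  On objects, preservation of the tensor operations means being a monoid morphism, including
  preservation of the identity element.
\<close>

definition preserves_tensor ::
  "'a invtensor_cat \<Rightarrow> 'b invtensor_cat \<Rightarrow> (nat \<Rightarrow> nat) \<Rightarrow> ('a \<Rightarrow> 'b) \<Rightarrow> bool" where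
  "preserves_tensor C D F f \<longleftrightarrow>
     F (tensor_unit C) = tensor_unit D \<and>
     (\<forall>m n. F (tensor_obj C m n) = tensor_obj D (F m) (F n)) \<and>
     (\<forall>m n s t. \<forall>a \<in> homs C m n. \<forall>b \<in> homs C s t.
        f (tensor C m n s t a b) = tensor D (F m) (F n) (F s) (F t) (f a) (f b))"

definition faithful_invol_tensor_functor ::
  "'a invtensor_cat \<Rightarrow> 'b invtensor_cat \<Rightarrow> (nat \<Rightarrow> nat) \<Rightarrow> ('a \<Rightarrow> 'b) \<Rightarrow> bool" where
  "faithful_invol_tensor_functor C D F f \<longleftrightarrow>
     is_functor C D F f \<and> faithful C F f \<and> preserves_invol C D f \<and> preserves_tensor C D F f"


section \<open>Partitions\<close>

text \<open>
  \<open>Upper x\<close>, \<open>Lower x\<close> and \<open>Middle x\<close> stand for $x$, $x'$ and $x''$; the last kind of vertex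
  occurs in product graphs only.
\<close>

datatype vertex = Upper nat | Lower nat | Middle nat

type_synonym partn = "vertex set set"

definition verts :: "nat \<Rightarrow> nat \<Rightarrow> vertex set" where
  "verts m n = Upper ` {1..m} \<union> Lower ` {1..n}"

definition P_hom :: "nat \<Rightarrow> nat \<Rightarrow> partn set" where
  "P_hom m n = {a. partition_on (verts m n) a}"

fun lower_to_middle :: "vertex \<Rightarrow> vertex" where
  "lower_to_middle (Lower x) = Middle x"
| "lower_to_middle v = v"

fun upper_to_middle :: "vertex \<Rightarrow> vertex" where
  "upper_to_middle (Upper x) = Middle x"
| "upper_to_middle v = v"

text \<open>
  A partition is represented by the graph in which any two vertices of the same block are joined
  (including loops). The edge relation of a product graph is therefore symmetric, and its reflexive
  transitive closure is the relation of lying in the same connected component.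
\<close>

definition product_verts :: "nat \<Rightarrow> nat \<Rightarrow> nat \<Rightarrow> vertex set" where
  "product_verts m n t = Upper ` {1..m} \<union> Middle ` {1..n} \<union> Lower ` {1..t}"

definition product_edges :: "partn \<Rightarrow> partn \<Rightarrow> (vertex \<times> vertex) set" where
  "product_edges a b =
     (\<Union>X\<in>a. lower_to_middle ` X \<times> lower_to_middle ` X) \<union>
     (\<Union>X\<in>b. upper_to_middle ` X \<times> upper_to_middle ` X)"

definition product_components :: "nat \<Rightarrow> nat \<Rightarrow> nat \<Rightarrow> partn \<Rightarrow> partn \<Rightarrow> vertex set set" where
  "product_components m n t a b = product_verts m n t // (product_edges a b)\<^sup>*"

definition partn_mult :: "nat \<Rightarrow> nat \<Rightarrow> nat \<Rightarrow> partn \<Rightarrow> partn \<Rightarrow> partn" where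
  "partn_mult m n t a b =
     verts m t // {(x, y). x \<in> verts m t \<and> y \<in> verts m t \<and>
                      (\<exists>X \<in> product_components m n t a b. x \<in> X \<and> y \<in> X)}"

definition Phi :: "nat \<Rightarrow> nat \<Rightarrow> nat \<Rightarrow> partn \<Rightarrow> partn \<Rightarrow> nat" where
  "Phi m n t a b = card {X \<in> product_components m n t a b. X \<subseteq> Middle ` {1..n}}"

definition partn_id :: "nat \<Rightarrow> partn" where
  "partn_id n = {{Upper i, Lower i} | i. i \<in> {1..n}}"

fun flip_vertex :: "vertex \<Rightarrow> vertex" where
  "flip_vertex (Upper x) = Lower x"
| "flip_vertex (Lower x) = Upper x"
| "flip_vertex (Middle x) = Middle x"

definition partn_star :: "partn \<Rightarrow> partn" where
  "partn_star a = (\<lambda>X. flip_vertex ` X) ` a"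

fun shift_vertex :: "nat \<Rightarrow> nat \<Rightarrow> vertex \<Rightarrow> vertex" where
  "shift_vertex m n (Upper x) = Upper (x + m)"
| "shift_vertex m n (Lower x) = Lower (x + n)"
| "shift_vertex m n (Middle x) = Middle x"

definition partn_sum :: "nat \<Rightarrow> nat \<Rightarrow> partn \<Rightarrow> partn \<Rightarrow> partn" where
  "partn_sum m n a b = a \<union> (\<lambda>X. shift_vertex m n ` X) ` b"

definition B_hom :: "nat \<Rightarrow> nat \<Rightarrow> partn set" where
  "B_hom m n = {a \<in> P_hom m n. \<forall>X \<in> a. card X = 2}"

fun position :: "vertex \<Rightarrow> real \<times> real" where
  "position (Upper x) = (real x, 1)"
| "position (Lower x) = (real x, 0)"
| "position (Middle x) = (real x, 1/2)"

text \<open>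
  A Brauer partition is drawn by choosing for each block \<open>{u, v}\<close> a simple arc in the strip
  $0 \leq y \leq 1$ joining the positions of \<open>u\<close> and \<open>v\<close>; the arcs are not allowed to meet.
\<close>

definition planar_drawing :: "partn \<Rightarrow> (vertex set \<Rightarrow> real \<Rightarrow> real \<times> real) \<Rightarrow> bool" where
  "planar_drawing a \<gamma> \<longleftrightarrow>
     (\<forall>X \<in> a. arc (\<gamma> X) \<and>
        {pathstart (\<gamma> X), pathfinish (\<gamma> X)} = position ` X \<and>
        path_image (\<gamma> X) \<subseteq> {(x, y). 0 \<le> y \<and> y \<le> 1}) \<and>
     (\<forall>X \<in> a. \<forall>Y \<in> a. X \<noteq> Y \<longrightarrow> path_image (\<gamma> X) \<inter> path_image (\<gamma> Y) = {})"

definition TL_hom :: "nat \<Rightarrow> nat \<Rightarrow> partn set" where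
  "TL_hom m n = {a \<in> B_hom m n. \<exists>\<gamma>. planar_drawing a \<gamma>}"


section \<open>The (twisted) diagram categories\<close>

text \<open>
  The constructions below are parametrised by the hom-sets \<open>H\<close> of one of the three categories
  of partitions.
\<close>

definition partn_cat :: "(nat \<Rightarrow> nat \<Rightarrow> partn set) \<Rightarrow> partn invtensor_cat" where
  "partn_cat H =
     \<lparr> homs = H,
       composite = partn_mult,
       identity = partn_id,
       invol = partn_star,
       tensor_obj = (+),
       tensor_unit = 0,
       tensor = (\<lambda>m n s t. partn_sum m n) \<rparr>"

definition twisted_cat :: "(nat \<Rightarrow> nat \<Rightarrow> partn set) \<Rightarrow> (nat \<times> partn) invtensor_cat" where
  "twisted_cat H =
     \<lparr> homs = (\<lambda>m n. UNIV \<times> H m n),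
       composite = (\<lambda>m n t (i, a) (j, b). (i + j + Phi m n t a b, partn_mult m n t a b)),
       identity = (\<lambda>n. (0, partn_id n)),
       invol = (\<lambda>(i, a). (i, partn_star a)),
       tensor_obj = (+),
       tensor_unit = 0,
       tensor = (\<lambda>m n s t (i, a) (j, b). (i + j, partn_sum m n a b)) \<rparr>"

datatype etw = Zero nat nat | Tw nat partn

definition truncate_tw :: "nat \<Rightarrow> nat \<Rightarrow> nat \<Rightarrow> nat \<Rightarrow> partn \<Rightarrow> etw" where
  "truncate_tw e m n k a = (if k \<le> e then Tw k a else Zero m n)"

fun etw_mult :: "nat \<Rightarrow> nat \<Rightarrow> nat \<Rightarrow> nat \<Rightarrow> etw \<Rightarrow> etw \<Rightarrow> etw" where
  "etw_mult e m n t (Tw i a) (Tw j b) =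
     truncate_tw e m t (i + j + Phi m n t a b) (partn_mult m n t a b)"
| "etw_mult e m n t _ _ = Zero m t"

fun etw_sum :: "nat \<Rightarrow> nat \<Rightarrow> nat \<Rightarrow> nat \<Rightarrow> nat \<Rightarrow> etw \<Rightarrow> etw \<Rightarrow> etw" where
  "etw_sum e m n s t (Tw i a) (Tw j b) =
     truncate_tw e (m + s) (n + t) (i + j) (partn_sum m n a b)"
| "etw_sum e m n s t _ _ = Zero (m + s) (n + t)"

fun etw_star :: "etw \<Rightarrow> etw" where
  "etw_star (Tw i a) = Tw i (partn_star a)"
| "etw_star (Zero m n) = Zero n m"

text \<open>\<open>Z m n\<close> says whether the hom-set from \<open>m\<close> to \<open>n\<close> contains a zero morphism.\<close>

definition etwisted_cat ::
  "nat \<Rightarrow> (nat \<Rightarrow> nat \<Rightarrow> bool) \<Rightarrow> (nat \<Rightarrow> nat \<Rightarrow> partn set) \<Rightarrow> etw invtensor_cat" where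
  "etwisted_cat e Z H =
     \<lparr> homs = (\<lambda>m n. {Tw i a | i a. i \<le> e \<and> a \<in> H m n} \<union> (if Z m n then {Zero m n} else {})),
       composite = etw_mult e,
       identity = (\<lambda>n. Tw 0 (partn_id n)),
       invol = etw_star,
       tensor_obj = (+),
       tensor_unit = 0,
       tensor = etw_sum e \<rparr>"

definition same_parity :: "nat \<Rightarrow> nat \<Rightarrow> bool" where
  "same_parity m n \<longleftrightarrow> m mod 2 = n mod 2"

abbreviation "\<P> \<equiv> partn_cat P_hom"
abbreviation "\<B> \<equiv> partn_cat B_hom"
abbreviation "\<T>\<L> \<equiv> partn_cat TL_hom"

abbreviation "\<P>\<Phi> \<equiv> twisted_cat P_hom"
abbreviation "\<B>\<Phi> \<equiv> twisted_cat B_hom"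
abbreviation "\<T>\<L>\<Phi> \<equiv> twisted_cat TL_hom"

abbreviation "\<P>\<Phi>e e \<equiv> etwisted_cat e (\<lambda>m n. True) P_hom"
abbreviation "\<B>\<Phi>e e \<equiv> etwisted_cat e same_parity B_hom"
abbreviation "\<T>\<L>\<Phi>e e \<equiv> etwisted_cat e same_parity TL_hom"


section \<open>The matrix category\<close>

definition kronecker :: "'k::semiring_1 mat \<Rightarrow> 'k mat \<Rightarrow> 'k mat" where
  "kronecker A B =
     mat (dim_row A * dim_row B) (dim_col A * dim_col B)
       (\<lambda>(i, j). A $$ (i div dim_row B, j div dim_col B) * B $$ (i mod dim_row B, j mod dim_col B))"

definition matrix_cat :: "'k::semiring_1 mat invtensor_cat" where
  "matrix_cat =
     \<lparr> homs = carrier_mat,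
       composite = (\<lambda>m n t A B. A * B),
       identity = one_mat,
       invol = transpose_mat,
       tensor_obj = (*),
       tensor_unit = 1,
       tensor = (\<lambda>m n s t. kronecker) \<rparr>"

end

theory Submission
  imports Defs
begin

text \<open>
  The dimensions are determined on objects alone. A tensor functor maps objects by a monoid morphism
  \<open>(\<nat>, +) \<rightarrow> (\<nat>, \<cdot>)\<close>, and \<open>(\<nat>, +)\<close> is free on the generator \<open>1\<close>, so \<open>n\<close> is sent to the \<open>n\<close>-th
  power of \<open>d = F 1\<close>. Injectivity on objects excludes the two values of \<open>d\<close> whose powers repeat:
  for \<open>d = 0\<close> the objects \<open>1\<close> and \<open>2\<close> would have the same image, and for \<open>d = 1\<close> all objects would.
  Untwisted, twisted and truncated diagram categories have the same objects and the same tensor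
  operation on them, so this single argument covers every case.
\<close>

lemma inj_monoid_morphism_add_mult_power:
  fixes F :: "nat \<Rightarrow> nat"
  assumes unit: "F 0 = 1" and mult: "\<And>m n. F (m + n) = F m * F n" and inj: "inj F"
  shows "\<exists>d\<ge>2. \<forall>n. F n = d ^ n"
proof -
  have power: "F n = F 1 ^ n" for n
  proof (induction n)
    case 0
    show ?case using unit by simp
  next
    case (Suc n)
    then show ?case using mult[of 1 n] by (metis plus_1_eq_Suc power_Suc)
  qed
  have "F 1 \<noteq> F 0" and "F 2 \<noteq> F 1"
    using inj by (simp_all add: inj_eq)
  then have "F 1 \<noteq> 1" and "F 1 \<noteq> 0"
    using unit power[of 2] by (fastforce, metis zero_power2)
  then have "F 1 \<ge> 2"
    by linarith
  with power show ?thesis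
    by blast
qed

lemma faithful_invol_tensor_functor_object_power:
  assumes "faithful_invol_tensor_functor C matrix_cat F f"
    and "tensor_obj C = (+)" and "tensor_unit C = 0"
  shows "\<exists>d\<ge>2. \<forall>n. F n = d ^ n"
proof (rule inj_monoid_morphism_add_mult_power)
  have tensor: "preserves_tensor C matrix_cat F f" and faithful: "faithful C F f"
    using assms(1) by (simp_all add: faithful_invol_tensor_functor_def)
  show "F 0 = 1" and "F (m + n) = F m * F n" for m n
    using tensor assms(2,3) by (simp_all add: preserves_tensor_def matrix_cat_def)
  show "inj F"
    using faithful by (simp add: faithful_def)
qed

theorem theorem3p14:
  shows
    "(\<forall>C \<in> {\<P>, \<B>, \<T>\<L>}. \<forall>F (\<psi> :: partn \<Rightarrow> 'k::semiring_1 mat).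
        faithful_invol_tensor_functor C matrix_cat F \<psi> \<longrightarrow> (\<exists>d\<ge>2. \<forall>n. F n = d ^ n)) \<and>
     (\<forall>C \<in> {\<P>\<Phi>, \<B>\<Phi>, \<T>\<L>\<Phi>}. \<forall>F (\<psi> :: nat \<times> partn \<Rightarrow> 'k mat).
        faithful_invol_tensor_functor C matrix_cat F \<psi> \<longrightarrow> (\<exists>d\<ge>2. \<forall>n. F n = d ^ n)) \<and>
     (\<forall>e. \<forall>C \<in> {\<P>\<Phi>e e, \<B>\<Phi>e e, \<T>\<L>\<Phi>e e}. \<forall>F (\<psi> :: etw \<Rightarrow> 'k mat).
        faithful_invol_tensor_functor C matrix_cat F \<psi> \<longrightarrow> (\<exists>d\<ge>2. \<forall>n. F n = d ^ n))"
  by (intro conjI allI ballI impI; erule faithful_invol_tensor_functor_object_power)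
    (auto simp: partn_cat_def twisted_cat_def etwisted_cat_def)

end
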